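(* Let $a_1 \geq a_2 \geq \dots \geq a_n > 0$ be the sizes of $n$ objects, let $S = \sum_{i=1}^n a_i$, let $C > 0$ be a bin capacity and let $m := \lceil S/C \rceil$. If $a_1 - a_n \leq C$ and $m \leq n$, then there exists a feasible balanced multistage allocation of the $n$ objects into $m$ bins of capacity $C$ using only $k = 2$ stages (i.e. BMBP$(A, C, m, 2)$ is true; since at least $\lceil S/C\rceil$ bins are always necessary, this number of bins is optimal). Moreover, such an allocation can be computed by an algorithm with running time $O(n \log n)$.
   Context: Balanced Multistage Bin Packing: given objects $I = \{1,\dots,n\}$ with sizes $A = (a_1,\dots,a_n)$, a bin capacity $C$, a set $J$ of $m$ bins and a number $k$ of stages $K = \{1,\dots,k\}$, the problem BMBP$(A,C,m,k)$ asks whether there exist $x_{ij}^\ell, y_j \in \{0,1\}$ and $\lambda_{ij}^\ell, \alpha_j^\ell \in [0,1]$ ($i\in I$, $j \in J$, $\ell \in K$) such that: $\sum_{i\in I}\sum_{\ell \in K} a_i \lambda_{ij}^\ell \leq C y_j$ for every $j \in J$ (capacity); $\sum_{j \in J}\sum_{\ell\in K} \lambda_{ij}^\ell = 1$ for every $i \in I$ (each object fully allocated); $\sum_{j\in J} x_{ij}^\ell \leq 1$ for every $i \in I$, $\ell \in K$ (at each stage each object is assigned to at most one bin); and $\lambda_{ij}^\ell = \alpha_j^\ell x_{ij}^\ell$ for all $i,j,\ell$ (balancing: at each stage, every object assigned to bin $j$ has the same fraction $\alpha_j^\ell$ of its size stored in bin $j$). *)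

theory Defs
  imports Complex_Main "HOL-Library.Landau_Symbols" "HOL-Combinatorics.Permutations"
begin

section \<open>Balanced multistage bin packing\<close>

text \<open>Objects are \<open>{1..n}\<close>, bins \<open>{1..m}\<close>, stages \<open>{1..k}\<close>; the values of the families
  outside these index ranges are irrelevant.\<close>

definition feasible ::
  "nat \<Rightarrow> (nat \<Rightarrow> real) \<Rightarrow> real \<Rightarrow> nat \<Rightarrow> nat \<Rightarrow>
   (nat \<Rightarrow> nat \<Rightarrow> nat \<Rightarrow> real) \<Rightarrow> (nat \<Rightarrow> real) \<Rightarrow>
   (nat \<Rightarrow> nat \<Rightarrow> nat \<Rightarrow> real) \<Rightarrow> (nat \<Rightarrow> nat \<Rightarrow> real) \<Rightarrow> bool" where
  "feasible n a C m k x y lam alpha \<longleftrightarrow>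
     (\<forall>i\<in>{1..n}. \<forall>j\<in>{1..m}. \<forall>l\<in>{1..k}. x i j l \<in> {0, 1}) \<and>
     (\<forall>j\<in>{1..m}. y j \<in> {0, 1}) \<and>
     (\<forall>i\<in>{1..n}. \<forall>j\<in>{1..m}. \<forall>l\<in>{1..k}. lam i j l \<in> {0..1}) \<and>
     (\<forall>j\<in>{1..m}. \<forall>l\<in>{1..k}. alpha j l \<in> {0..1}) \<and>
     (\<forall>j\<in>{1..m}. (\<Sum>i\<in>{1..n}. \<Sum>l\<in>{1..k}. a i * lam i j l) \<le> C * y j) \<and>
     (\<forall>i\<in>{1..n}. (\<Sum>j\<in>{1..m}. \<Sum>l\<in>{1..k}. lam i j l) = 1) \<and>
     (\<forall>i\<in>{1..n}. \<forall>l\<in>{1..k}. (\<Sum>j\<in>{1..m}. x i j l) \<le> 1) \<and>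
     (\<forall>i\<in>{1..n}. \<forall>j\<in>{1..m}. \<forall>l\<in>{1..k}. lam i j l = alpha j l * x i j l)"

definition BMBP :: "nat \<Rightarrow> (nat \<Rightarrow> real) \<Rightarrow> real \<Rightarrow> nat \<Rightarrow> nat \<Rightarrow> bool" where
  "BMBP n a C m k \<longleftrightarrow> (\<exists>x y lam alpha. feasible n a C m k x y lam alpha)"

section \<open>Algorithms and their running time\<close>

text \<open>
  Algorithms are programs of a first-order, call-by-value functional language over real numbers
  and (linked) lists. Every evaluation step costs one unit, including exact arithmetic on reals and
  comparison of reals, as usual on a real RAM; there is no rounding operation. All steps are
  constant-time on a real RAM (for a fixed program the environments have bounded length, and list
  cells are shared, not copied), so a time bound in this model carries over to the real RAM.

  A program is a list of unary functions, given by their bodies. Variables are de Bruijn indices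
  into the environment: a function body starts in the environment that contains just its argument,
  \<open>LetE\<close> binds index 0 in its second argument, and the last argument of \<open>CaseE\<close> is evaluated with
  the head (index 0) and the tail (index 1) of the scrutinised nonempty list.
\<close>

datatype val = Num real | List "val list"

datatype arith = Add | Sub | Mul | Div

datatype expr =
    Lit int
  | Var nat
  | Arith arith expr expr
  | IfLe expr expr expr expr
  | LetE expr expr
  | NilE
  | ConsE expr expr
  | CaseE expr expr expr
  | Call nat expr

type_synonym prog = "expr list"

fun arith_defined :: "arith \<Rightarrow> real \<Rightarrow> real \<Rightarrow> bool" where
  "arith_defined Div r s \<longleftrightarrow> s \<noteq> 0"
| "arith_defined _ r s \<longleftrightarrow> True"

fun arith_val :: "arith \<Rightarrow> real \<Rightarrow> real \<Rightarrow> real" where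
  "arith_val Add r s = r + s"
| "arith_val Sub r s = r - s"
| "arith_val Mul r s = r * s"
| "arith_val Div r s = r / s"

text \<open>\<open>evaluates P env e v t\<close>: in the environment \<open>env\<close>, the expression \<open>e\<close> evaluates to \<open>v\<close> in
  exactly \<open>t\<close> steps. Ill-typed expressions, divisions by zero and nonterminating evaluations have
  no value.\<close>

inductive evaluates :: "prog \<Rightarrow> val list \<Rightarrow> expr \<Rightarrow> val \<Rightarrow> nat \<Rightarrow> bool" for P :: prog where
  Lit: "evaluates P env (Lit z) (Num (of_int z)) 1"
| Var: "i < length env \<Longrightarrow> evaluates P env (Var i) (env ! i) 1"
| Arith: "evaluates P env e1 (Num r) s \<Longrightarrow> evaluates P env e2 (Num r') t \<Longrightarrow> arith_defined f r r' \<Longrightarrow>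
    evaluates P env (Arith f e1 e2) (Num (arith_val f r r')) (1 + s + t)"
| IfLeTrue: "evaluates P env e1 (Num r) s \<Longrightarrow> evaluates P env e2 (Num r') t \<Longrightarrow> r \<le> r' \<Longrightarrow>
    evaluates P env e3 v u \<Longrightarrow> evaluates P env (IfLe e1 e2 e3 e4) v (1 + s + t + u)"
| IfLeFalse: "evaluates P env e1 (Num r) s \<Longrightarrow> evaluates P env e2 (Num r') t \<Longrightarrow> \<not> r \<le> r' \<Longrightarrow>
    evaluates P env e4 v u \<Longrightarrow> evaluates P env (IfLe e1 e2 e3 e4) v (1 + s + t + u)"
| LetE: "evaluates P env e1 v s \<Longrightarrow> evaluates P (v # env) e2 w t \<Longrightarrow>
    evaluates P env (LetE e1 e2) w (1 + s + t)"
| NilE: "evaluates P env NilE (List []) 1"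
| ConsE: "evaluates P env e1 v s \<Longrightarrow> evaluates P env e2 (List vs) t \<Longrightarrow>
    evaluates P env (ConsE e1 e2) (List (v # vs)) (1 + s + t)"
| CaseNil: "evaluates P env e1 (List []) s \<Longrightarrow> evaluates P env e2 w t \<Longrightarrow>
    evaluates P env (CaseE e1 e2 e3) w (1 + s + t)"
| CaseCons: "evaluates P env e1 (List (v # vs)) s \<Longrightarrow> evaluates P (v # List vs # env) e3 w t \<Longrightarrow>
    evaluates P env (CaseE e1 e2 e3) w (1 + s + t)"
| Call: "evaluates P env e v s \<Longrightarrow> f < length P \<Longrightarrow> evaluates P [v] (P ! f) w t \<Longrightarrow>
    evaluates P env (Call f e) w (1 + s + t)"

lemma evaluates_deterministic:
  "evaluates P env e v s \<Longrightarrow> evaluates P env e w t \<Longrightarrow> v = w \<and> s = t"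
proof (induction arbitrary: w t rule: evaluates.induct)
  case Lit
  from Lit.prems show ?case
    by (cases rule: evaluates.cases) auto
next
  case Var
  from Var.prems show ?case
    by (cases rule: evaluates.cases) auto
next
  case Arith
  from Arith.prems show ?case
    by (cases rule: evaluates.cases) (use Arith.hyps in \<open>auto dest!: Arith.IH\<close>)
next
  case IfLeTrue
  from IfLeTrue.prems show ?case
    by (cases rule: evaluates.cases) (use IfLeTrue.hyps in \<open>auto dest!: IfLeTrue.IH\<close>)
next
  case IfLeFalse
  from IfLeFalse.prems show ?case
    by (cases rule: evaluates.cases) (use IfLeFalse.hyps in \<open>auto dest!: IfLeFalse.IH\<close>)
next
  case LetE
  from LetE.prems show ?case
    by (cases rule: evaluates.cases) (use LetE.hyps in \<open>auto dest!: LetE.IH\<close>)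
next
  case NilE
  from NilE.prems show ?case
    by (cases rule: evaluates.cases) auto
next
  case ConsE
  from ConsE.prems show ?case
    by (cases rule: evaluates.cases) (use ConsE.hyps in \<open>auto dest!: ConsE.IH\<close>)
next
  case CaseNil
  from CaseNil.prems show ?case
    by (cases rule: evaluates.cases) (use CaseNil.hyps in \<open>auto dest!: CaseNil.IH\<close>)
next
  case CaseCons
  from CaseCons.prems show ?case
    by (cases rule: evaluates.cases) (use CaseCons.hyps in \<open>auto dest!: CaseCons.IH\<close>)
next
  case Call
  from Call.prems show ?case
    by (cases rule: evaluates.cases) (use Call.hyps in \<open>auto dest!: Call.IH\<close>)
qed

definition runs :: "prog \<Rightarrow> val \<Rightarrow> val \<Rightarrow> nat \<Rightarrow> bool" where
  "runs P v w t \<longleftrightarrow> evaluates P [v] (Call 0 (Var 0)) w t"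

definition input_val :: "nat \<Rightarrow> (nat \<Rightarrow> real) \<Rightarrow> real \<Rightarrow> val" where
  "input_val n a C = List [Num C, List (map (\<lambda>i. Num (a i)) [1..<Suc n])]"

text \<open>
  A solution consists of families with up to \<open>2 * n * m\<close> members, too many to be written down one by
  one in time \<open>O(n log n)\<close>. Each of the four families is therefore output as a list of
  (index tuple, value) entries; members without an entry are 0.
\<close>

definition entries_val :: "(nat list \<times> real) list \<Rightarrow> val" where
  "entries_val es =
     List (map (\<lambda>(ks, r). List [List (map (\<lambda>k. Num (real k)) ks), Num r]) es)"

definition entry :: "(nat list \<times> real) list \<Rightarrow> nat list \<Rightarrow> real" where
  "entry es ks = (case map_of es ks of None \<Rightarrow> 0 | Some r \<Rightarrow> r)"

definition encodes ::
  "val \<Rightarrow> (nat \<Rightarrow> nat \<Rightarrow> nat \<Rightarrow> real) \<Rightarrow> (nat \<Rightarrow> real) \<Rightarrow>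
   (nat \<Rightarrow> nat \<Rightarrow> nat \<Rightarrow> real) \<Rightarrow> (nat \<Rightarrow> nat \<Rightarrow> real) \<Rightarrow> bool" where
  "encodes w x y lam alpha \<longleftrightarrow>
     (\<exists>ex ey el ea.
        w = List [entries_val ex, entries_val ey, entries_val el, entries_val ea] \<and>
        x = (\<lambda>i j l. entry ex [i, j, l]) \<and>
        y = (\<lambda>j. entry ey [j]) \<and>
        lam = (\<lambda>i j l. entry el [i, j, l]) \<and>
        alpha = (\<lambda>j l. entry ea [j, l]))"

end

(*
  No sorting is needed. The bins are opened one after the other and filled to capacity. The objects
  whose first stage is in bin j form a group of total size g; if the room left in bin j is c \<le> g,
  then a fraction c / g of the group goes into bin j, and the rest, of size g - c, goes into bin
  j + 1 in the second stage. This works whenever g \<le> C + c, since then the rest fits into bin j + 1.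
  As long as there is a big object (one larger than C), a group consists of a single object: a big
  one if it respects g \<le> C + c, and otherwise a small one, which still fills the room because sizes
  differ by at most C. Every bin thus uses up one object, so m \<le> n guarantees that the small objects
  do not run out before the big ones. Once only small objects are left, they are added to the group
  until it fills the room.
*)

theory Submission
  imports Defs
begin

section \<open>Symbolic evaluation\<close>

inductive_simps evaluates_simps [simp]:
  "evaluates P env (Lit z) w t"
  "evaluates P env (Var i) w t"
  "evaluates P env NilE w t"
  "evaluates P env (Arith f e1 e2) w t"
  "evaluates P env (ConsE e1 e2) w t"
  "evaluates P env (LetE e1 e2) w t"
  "evaluates P env (Call f e) w t"

inductive_simps evaluates_IfLe: "evaluates P env (IfLe e1 e2 e3 e4) w t"
inductive_simps evaluates_CaseE: "evaluates P env (CaseE e1 e2 e3) w t"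

text \<open>Merges both rules for \<open>CaseE\<close>, so that the scrutinee occurs only once;
  \<open>evaluates_CaseE\<close> repeats it in both disjuncts, which multiplies under
  nesting.\<close>

lemma evaluates_CaseE_iff [simp]:
  "evaluates P env (CaseE e1 e2 e3) w t \<longleftrightarrow>
     (\<exists>vs s u. evaluates P env e1 (List vs) s \<and>
        (case vs of [] \<Rightarrow> evaluates P env e2 w u
         | v # vs' \<Rightarrow> evaluates P (v # List vs' # env) e3 w u) \<and> t = 1 + s + u)"
  (is "?L = ?R")
proof
  assume ?L then show ?R unfolding evaluates_CaseE
    by (elim disjE exE conjE) (intro exI conjI; assumption?; simp)+
next
  assume ?R then obtain vs s u where "evaluates P env e1 (List vs) s" "t = 1 + s + u"
     "case vs of [] \<Rightarrow> evaluates P env e2 w u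
         | v # vs' \<Rightarrow> evaluates P (v # List vs' # env) e3 w u" by blast
  then show ?L by (cases vs) (simp_all add: evaluates.CaseNil[simplified] evaluates.CaseCons[simplified])
qed

lemma evaluates_IfLe_iff [simp]:
  "evaluates P env (IfLe e1 e2 e3 e4) w t \<longleftrightarrow>
     (\<exists>r s r' s' u. evaluates P env e1 (Num r) s \<and> evaluates P env e2 (Num r') s' \<and>
        evaluates P env (if r \<le> r' then e3 else e4) w u \<and> t = 1 + s + s' + u)"
  (is "?L = ?R")
proof
  assume ?L then show ?R unfolding evaluates_IfLe
    by (elim disjE exE conjE) (intro exI conjI; assumption?; simp)+
next
  assume ?R then obtain r s r' s' u where "evaluates P env e1 (Num r) s" "evaluates P env e2 (Num r') s'"
     "t = 1 + s + s' + u" "evaluates P env (if r \<le> r' then e3 else e4) w u" by blast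
  then show ?L by (cases "r \<le> r'") (simp_all add: evaluates.IfLeTrue[simplified] evaluates.IfLeFalse[simplified])
qed

text \<open>By determinism, one known evaluation becomes a rewrite rule. Calls and induction
  hypotheses enter the symbolic evaluation in this form.\<close>

lemma evaluates_unique_iff:
  "evaluates P env e v s \<Longrightarrow> evaluates P env e w t \<longleftrightarrow> w = v \<and> t = s"
  using evaluates_deterministic by blast

fun tup :: "expr list \<Rightarrow> expr" where
  "tup [] = NilE"
| "tup (e # es) = ConsE e (tup es)"

text \<open>Projection to a component of a tuple. \<open>NilE\<close> only fills the branch for
  lists that are too short.\<close>

fun fld :: "nat \<Rightarrow> expr \<Rightarrow> expr" where
  "fld 0 e = CaseE e NilE (Var 0)"
| "fld (Suc k) e = CaseE e NilE (fld k (Var 1))"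

lemma evaluates_fld:
  "evaluates P env e (List vs) s \<Longrightarrow> k < length vs \<Longrightarrow>
    evaluates P env (fld k e) (vs ! k) (s + 2 + 2 * k)"
proof (induction k arbitrary: env e vs s)
  case 0
  then obtain v vs' where vs: "vs = v # vs'" by (cases vs) auto
  have "evaluates P (v # List vs' # env) (Var 0) v 1" by simp
  from evaluates.CaseCons[OF 0(1)[unfolded vs] this] show ?case by (simp add: vs)
next
  case (Suc k)
  then obtain v vs' where vs: "vs = v # vs'" by (cases vs) auto
  have "evaluates P (v # List vs' # env) (fld k (Var 1)) (vs' ! k) (1 + 2 + 2 * k)"
    using Suc.prems vs by (intro Suc.IH) auto
  from evaluates.CaseCons[OF Suc.prems(1)[unfolded vs] this] show ?case by (simp add: vs)
qed

lemma evaluates_fld_Var_iff [simp]: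
  "i < length env \<Longrightarrow> env ! i = List vs \<Longrightarrow> k < length vs \<Longrightarrow>
    evaluates P env (fld k (Var i)) v t \<longleftrightarrow> v = vs ! k \<and> t = 3 + 2 * k"
  using evaluates_unique_iff[OF evaluates_fld[of P env "Var i" vs 1 k]] by (simp add: numeral_3_eq_3)

declare fld.simps [simp del]

definition ent :: "expr list \<Rightarrow> expr \<Rightarrow> expr" where
  "ent ks e = tup [tup ks, e]"

section \<open>The program\<close>

text \<open>In the environment of the innermost \<open>IfLe\<close>, the indices 0 to 4 denote the current object with
  its number, the result for the remaining list, the current size, the remaining list and the
  argument \<open>[C, k, list]\<close>.\<close>

definition split_body :: expr where
  "split_body =
     CaseE (fld 2 (Var 0)) (tup [NilE, NilE])
       (LetE (Call 1 (tup [fld 0 (Var 2), Arith Add (fld 1 (Var 2)) (Lit 1), Var 1]))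
         (LetE (tup [fld 1 (Var 3), Var 1])
           (IfLe (Var 2) (fld 0 (Var 4))
             (tup [fld 0 (Var 1), ConsE (Var 0) (fld 1 (Var 1))])
             (tup [ConsE (Var 0) (fld 0 (Var 1)), fld 1 (Var 1)]))))"

text \<open>The functions 2 and 3 get a state \<open>[C, j, c, g, B, S]\<close>: bin \<open>j\<close> has room \<open>c\<close>, its current
  group has total size \<open>g\<close>, and \<open>B\<close> and \<open>S\<close> are the remaining big and small objects.\<close>

definition pick_body :: expr where
  "pick_body =
     CaseE (fld 4 (Var 0))
       (CaseE (fld 5 (Var 0)) NilE (tup [Var 0, NilE, Var 1]))
       (IfLe (Arith Add (fld 3 (Var 2)) (fld 1 (Var 0))) (Arith Add (fld 0 (Var 2)) (fld 2 (Var 2)))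
         (tup [Var 0, Var 1, fld 5 (Var 2)])
         (CaseE (fld 5 (Var 2)) NilE (tup [Var 0, fld 4 (Var 4), Var 1])))"

text \<open>\<open>close_expr\<close> and \<open>continue_expr\<close> are evaluated in the environment [new group size, picked
  object, remaining lists, state], and \<open>emit_expr\<close> has in addition their result at index 0. The first
  component of every result is the fraction of the current group that goes into bin \<open>j\<close>. It is known
  only when the group is complete and is passed back through the recursion, so that every object is
  handled once.\<close>

definition close_expr :: expr where
  "close_expr =
     LetE (Arith Div (fld 2 (Var 3)) (Var 0))
       (LetE (Call 3 (tup [fld 0 (Var 4), Arith Add (fld 1 (Var 4)) (Lit 1),
            Arith Sub (Arith Add (fld 0 (Var 4)) (fld 2 (Var 4))) (Var 1), Lit 0,
            fld 0 (Var 3), fld 1 (Var 3)]))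
         (tup [Var 1, fld 1 (Var 0),
            ConsE (ent [fld 1 (Var 5)] (Lit 1)) (fld 2 (Var 0)),
            fld 3 (Var 0),
            ConsE (ent [fld 1 (Var 5), Lit 1] (Var 1))
              (ConsE (ent [Arith Add (fld 1 (Var 5)) (Lit 1), Lit 2] (Arith Sub (Lit 1) (Var 1)))
                (fld 4 (Var 0)))]))"

definition continue_expr :: expr where
  "continue_expr =
     Call 3 (tup [fld 0 (Var 3), fld 1 (Var 3), fld 2 (Var 3), Var 0, fld 0 (Var 2), fld 1 (Var 2)])"

definition emit_expr :: expr where
  "emit_expr =
     tup [fld 0 (Var 0),
       ConsE (ent [fld 0 (Var 2), fld 1 (Var 4), Lit 1] (Lit 1))
         (ConsE (ent [fld 0 (Var 2), Arith Add (fld 1 (Var 4)) (Lit 1), Lit 2] (Lit 1))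
           (fld 1 (Var 0))),
       fld 2 (Var 0),
       ConsE (ent [fld 0 (Var 2), fld 1 (Var 4), Lit 1] (fld 0 (Var 0)))
         (ConsE (ent [fld 0 (Var 2), Arith Add (fld 1 (Var 4)) (Lit 1), Lit 2]
              (Arith Sub (Lit 1) (fld 0 (Var 0))))
           (fld 3 (Var 0))),
       fld 4 (Var 0)]"

definition pack_body :: expr where
  "pack_body =
     CaseE (Call 2 (Var 0))
       (tup [Lit 1, NilE, tup [ent [fld 1 (Var 0)] (Lit 1)], NilE,
          tup [ent [fld 1 (Var 0), Lit 1] (Lit 1),
               ent [Arith Add (fld 1 (Var 0)) (Lit 1), Lit 2] (Arith Sub (Lit 1) (Lit 1))]])
       (LetE (Arith Add (fld 3 (Var 2)) (fld 1 (Var 0)))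
         (LetE (IfLe (fld 2 (Var 3)) (Var 0) close_expr continue_expr) emit_expr))"

text \<open>The final \<open>Var 1\<close> is the tail of the result: it drops the fraction of the
  first group and keeps the four families.\<close>

definition main_body :: expr where
  "main_body =
     LetE (Call 1 (tup [fld 0 (Var 0), Lit 1, fld 1 (Var 0)]))
       (CaseE (Call 3 (tup [fld 0 (Var 1), Lit 1, fld 0 (Var 1), Lit 0, fld 0 (Var 0), fld 1 (Var 0)]))
         NilE (Var 1))"

definition packer :: prog where
  "packer = [main_body, split_body, pick_body, pack_body]"

lemma length_packer [simp]: "length packer = 4"
  by (simp add: packer_def)

lemma packer_nth:
  "packer ! 0 = main_body" "packer ! 1 = split_body" "packer ! Suc 0 = split_body"
  "packer ! 2 = pick_body" "packer ! 3 = pack_body"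
  by (simp_all add: packer_def)

section \<open>Functional model of the program and its running time\<close>

definition item_val :: "(nat \<Rightarrow> real) \<Rightarrow> nat \<Rightarrow> val" where
  "item_val a i = List [Num (real i), Num (a i)]"

lemma evaluates_split:
  "\<exists>t. evaluates packer [List [Num C, Num (real k), List (map (\<lambda>i. Num (a i)) [k..<n])]] split_body
     (List [List (map (item_val a) (filter (\<lambda>i. \<not> a i \<le> C) [k..<n])),
            List (map (item_val a) (filter (\<lambda>i. a i \<le> C) [k..<n]))]) t \<and> t \<le> 100 * (n - k) + 100"
proof (induction "n - k" arbitrary: k)
  case 0
  then show ?case by (simp add: split_body_def)
next
  case (Suc d)
  then have k: "k < n" and "d = n - Suc k" by auto
  then obtain t where t: "evaluates packer [List [Num C, Num (real (Suc k)), List (map (\<lambda>i. Num (a i)) [Suc k..<n])]] split_body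
     (List [List (map (item_val a) (filter (\<lambda>i. \<not> a i \<le> C) [Suc k..<n])),
            List (map (item_val a) (filter (\<lambda>i. a i \<le> C) [Suc k..<n]))]) t" "t \<le> 100 * (n - Suc k) + 100"
    using Suc.hyps(1)[of "Suc k"] by blast
  \<comment> \<open>The program counts by adding 1 to a real, so its argument has the form
    \<open>real k + 1\<close>.\<close>
  note t1 = evaluates_unique_iff[OF t(1)[unfolded of_nat_Suc add.commute[of 1 "real k"]]]
  show ?case
    using k t(2) by (subst split_body_def, cases "a k \<le> C")
      (auto simp: upt_conv_Cons packer_nth t1 item_val_def)
qed

text \<open>The bound \<open>r\<close> will be \<open>C + c - g\<close>, what bin j and the next bin
  can still take beyond the group. Only big objects are compared with it; a small one respects it
  whenever \<open>g \<le> c\<close>.\<close>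

fun pick :: "(nat \<Rightarrow> real) \<Rightarrow> real \<Rightarrow> nat list \<Rightarrow> nat list \<Rightarrow> (nat \<times> nat list \<times> nat list) option" where
  "pick a r [] [] = None"
| "pick a r [] (s # S) = Some (s, [], S)"
| "pick a r (b # B) S =
     (if a b \<le> r then Some (b, B, S)
      else case S of [] \<Rightarrow> None | s # S' \<Rightarrow> Some (s, b # B, S'))"

lemma mset_pick: "pick a r B S = Some (i, B', S') \<Longrightarrow> mset (B @ S) = add_mset i (mset (B' @ S'))"
  by (induction a r B S rule: pick.induct) (auto split: if_splits list.splits)

lemma length_pick: "pick a r B S = Some (i, B', S') \<Longrightarrow> length B' + length S' < length B + length S"
  by (induction a r B S rule: pick.induct) (auto split: if_splits list.splits)

text \<open>\<open>pack a C j c g B S\<close> returns the fraction \<open>p\<close> of the current group that goes into bin \<open>j\<close>, a list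
  of (object, first bin, fraction in that bin) and a list of (bin, its fraction in stage 1). In stage 2
  the complementary fraction belongs to the next bin. If the last group ends up in bin \<open>m\<close>, the bin
  \<open>m + 1\<close> may also be listed; its entries are outside the index range of \<open>feasible\<close>.\<close>

function pack :: "(nat \<Rightarrow> real) \<Rightarrow> real \<Rightarrow> nat \<Rightarrow> real \<Rightarrow> real \<Rightarrow> nat list \<Rightarrow> nat list \<Rightarrow>
    real \<times> (nat \<times> nat \<times> real) list \<times> (nat \<times> real) list" where
  "pack a C j c g B S =
     (case pick a (C + c - g) B S of
        None \<Rightarrow> (1, [], [(j, 1)])
      | Some (i, B', S') \<Rightarrow>
          if c \<le> g + a i then
            case pack a C (Suc j) (C + c - (g + a i)) 0 B' S' of
              (p, its, bs) \<Rightarrow> (c / (g + a i), (i, j, c / (g + a i)) # its, (j, c / (g + a i)) # bs)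
          else
            case pack a C j c (g + a i) B' S' of (p, its, bs) \<Rightarrow> (p, (i, j, p) # its, bs))"
  by pat_completeness auto
termination
  by (relation "measure (\<lambda>(a, C, j, c, g, B, S). length B + length S)") (auto dest: length_pick)

declare pack.simps [simp del]

text \<open>\<open>f\<close> and \<open>g\<close> turn the fraction into the values for stages 1 and
  2, so that one list yields both \<open>x\<close> (constant 1) and \<open>lam\<close> (p and 1 -
  p).\<close>

definition item_entries ::
  "(real \<Rightarrow> real) \<Rightarrow> (real \<Rightarrow> real) \<Rightarrow> (nat \<times> nat \<times> real) list \<Rightarrow> (nat list \<times> real) list" where
  "item_entries f g its = concat (map (\<lambda>(i, j, p). [([i, j, 1], f p), ([i, Suc j, 2], g p)]) its)"

definition alpha_entries :: "(nat \<times> real) list \<Rightarrow> (nat list \<times> real) list" where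
  "alpha_entries bs = concat (map (\<lambda>(j, p). [([j, 1], p), ([Suc j, 2], 1 - p)]) bs)"

definition y_entries :: "(nat \<times> real) list \<Rightarrow> (nat list \<times> real) list" where
  "y_entries bs = map (\<lambda>(j, p). ([j], 1)) bs"

fun pack_vals :: "real \<times> (nat \<times> nat \<times> real) list \<times> (nat \<times> real) list \<Rightarrow> val list" where
  "pack_vals (p, its, bs) =
     [Num p, entries_val (item_entries (\<lambda>_. 1) (\<lambda>_. 1) its), entries_val (y_entries bs),
      entries_val (item_entries (\<lambda>p. p) (\<lambda>p. 1 - p) its), entries_val (alpha_entries bs)]"

definition state_val :: "(nat \<Rightarrow> real) \<Rightarrow> real \<Rightarrow> nat \<Rightarrow> real \<Rightarrow> real \<Rightarrow> nat list \<Rightarrow> nat list \<Rightarrow> val" where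
  "state_val a C j c g B S =
     List [Num C, Num (real j), Num c, Num g, List (map (item_val a) B), List (map (item_val a) S)]"

fun pick_val :: "(nat \<Rightarrow> real) \<Rightarrow> (nat \<times> nat list \<times> nat list) option \<Rightarrow> val" where
  "pick_val a None = List []"
| "pick_val a (Some (i, B, S)) =
     List [item_val a i, List (map (item_val a) B), List (map (item_val a) S)]"

lemma evaluates_pick:
  "\<exists>t. evaluates packer [state_val a C j c g B S] pick_body (pick_val a (pick a (C + c - g) B S)) t \<and> t \<le> 100"
proof (cases B)
  case Nil
  then show ?thesis by (cases S) (simp_all add: pick_body_def state_val_def)
next
  case (Cons b B')
  then show ?thesis
    by (cases "g + a b \<le> C + c"; cases S)
      (simp_all add: pick_body_def state_val_def item_val_def algebra_simps)
qed

text \<open>Each call consumes one object at bounded cost, for which 1000 is a generous bound. The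
  hypotheses keep the divisor in \<open>close_expr\<close> positive.\<close>

lemma evaluates_pack:
  "0 \<le> g \<Longrightarrow> (\<And>i. i \<in> set B \<union> set S \<Longrightarrow> 0 < a i) \<Longrightarrow>
   \<exists>t. evaluates packer [state_val a C j c g B S] pack_body (List (pack_vals (pack a C j c g B S))) t \<and>
     t \<le> 1000 * (length B + length S) + 1000"
proof (induction a C j c g B S rule: pack.induct)
  case (1 a C j c g B S)
  obtain tp where tp: "evaluates packer [state_val a C j c g B S] pick_body (pick_val a (pick a (C + c - g) B S)) tp" "tp \<le> 100"
    using evaluates_pick by blast
  show ?case
  proof (cases "pick a (C + c - g) B S")
    case None
    note tp1 = evaluates_unique_iff[OF tp(1)[unfolded None state_val_def]]
    show ?thesis
      using tp(2)
        by (subst pack.simps, subst pack_body_def)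
          (simp add: None packer_nth tp1 state_val_def ent_def entries_val_def item_entries_def alpha_entries_def y_entries_def)
  next
    case (Some x)
    obtain i B' S' where x: "x = (i, B', S')" by (cases x)
    note Some = Some[unfolded x]
    have m: "mset B + mset S = add_mset i (mset B' + mset S')"
      using mset_pick[OF Some] by simp
    then have set: "set B \<union> set S = insert i (set B' \<union> set S')"
      by (metis set_mset_add_mset_insert set_mset_mset set_mset_union)
    have len: "length B + length S = Suc (length B' + length S')"
      using arg_cong[OF m, of size] by simp
    have ai: "0 < g + a i" and pos: "\<And>k. k \<in> set B' \<union> set S' \<Longrightarrow> 0 < a k"
      using 1(3,4) set by (auto simp: add_nonneg_pos)
    note tp1 = evaluates_unique_iff[OF tp(1)[unfolded Some state_val_def pick_val.simps]]
    show ?thesis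
    proof (cases "c \<le> g + a i")
      case True
      obtain t where t: "evaluates packer [state_val a C (Suc j) (C + c - (g + a i)) 0 B' S'] pack_body 
           (List (pack_vals (pack a C (Suc j) (C + c - (g + a i)) 0 B' S'))) t"
         "t \<le> 1000 * (length B' + length S') + 1000"
        using 1(1)[OF Some refl refl True] pos by auto
      obtain p its bs where r: "pack a C (Suc j) (C + c - (g + a i)) 0 B' S' = (p, its, bs)"
        by (cases "pack a C (Suc j) (C + c - (g + a i)) 0 B' S'")
      note t1 = evaluates_unique_iff[OF t(1)[unfolded r state_val_def of_nat_Suc add.commute[of 1 "real j"]]]
      show ?thesis
        using tp(2) t(2) len True ai
        by (subst pack.simps, subst pack_body_def)
          (simp add: Some True r packer_nth tp1 t1 state_val_def close_expr_def emit_expr_def item_val_def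
          ent_def entries_val_def item_entries_def alpha_entries_def y_entries_def)
    next
      case False
      obtain t where t: "evaluates packer [state_val a C j c (g + a i) B' S'] pack_body 
           (List (pack_vals (pack a C j c (g + a i) B' S'))) t"
         "t \<le> 1000 * (length B' + length S') + 1000"
        using 1(2)[OF Some refl refl False] pos ai by auto
      obtain p its bs where r: "pack a C j c (g + a i) B' S' = (p, its, bs)"
        by (cases "pack a C j c (g + a i) B' S'")
      note t1 = evaluates_unique_iff[OF t(1)[unfolded r state_val_def]]
      show ?thesis
        using tp(2) t(2) len False ai
        by (subst pack.simps, subst pack_body_def)
          (simp add: Some False r packer_nth tp1 t1 state_val_def continue_expr_def emit_expr_def item_val_def
          ent_def entries_val_def item_entries_def alpha_entries_def y_entries_def)
    qed
  qed
qed

text \<open>Splitting costs at most 100 and packing at most 1000 steps per object; 2000 covers the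
  constant terms.\<close>

lemma runs_packer:
  assumes "\<And>i. i \<in> {1..n} \<Longrightarrow> 0 < a i"
  shows "\<exists>t. runs packer (input_val n a C)
      (List (tl (pack_vals (pack a C 1 C 0 (filter (\<lambda>i. \<not> a i \<le> C) [1..<Suc n]) (filter (\<lambda>i. a i \<le> C) [1..<Suc n]))))) t \<and>
    t \<le> 1100 * n + 2000"
proof -
  let ?B = "filter (\<lambda>i. \<not> a i \<le> C) [1..<Suc n]" and ?S = "filter (\<lambda>i. a i \<le> C) [1..<Suc n]"
  note upt_Suc [simp del]
  obtain t where t: "evaluates packer [List [Num C, Num (real 1), List (map (\<lambda>i. Num (a i)) [1..<Suc n])]] split_body
     (List [List (map (item_val a) ?B), List (map (item_val a) ?S)]) t" "t \<le> 100 * (Suc n - 1) + 100"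
    using evaluates_split by blast
  obtain u where u: "evaluates packer [state_val a C 1 C 0 ?B ?S] pack_body (List (pack_vals (pack a C 1 C 0 ?B ?S))) u"
    "u \<le> 1000 * (length ?B + length ?S) + 1000"
    using evaluates_pack[of 0 ?B ?S a C 1 C] assms by (auto simp: less_Suc_eq_le)
  have len: "length ?B + length ?S = n"
    using sum_length_filter_compl[of "\<lambda>i. a i \<le> C" "[1..<Suc n]"] by simp
  obtain p its bs where r: "pack a C 1 C 0 ?B ?S = (p, its, bs)"
    by (cases "pack a C 1 C 0 ?B ?S")
  note t1 = evaluates_unique_iff[OF t(1)[simplified]]
  note u1 = evaluates_unique_iff[OF u(1)[unfolded r state_val_def, simplified]]
  show ?thesis
    using t(2) u(2) len
    by (simp add: runs_def packer_nth main_body_def input_val_def t1 u1 r[unfolded One_nat_def])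
qed

section \<open>Reading the families off the output\<close>

lemma item_entries_simps [simp]:
  "item_entries f g [] = []"
  "item_entries f g ((i, j, p) # its) = ([i, j, 1], f p) # ([i, Suc j, 2], g p) # item_entries f g its"
  by (simp_all add: item_entries_def)

lemma map_of_item_entries_eq_None:
  "i \<notin> fst ` set its \<Longrightarrow> map_of (item_entries f g its) (i # ks) = None"
  by (induction its) auto

text \<open>\<open>map_of\<close> returns the first match; since no object is listed twice, this is
  the object's own entry.\<close>

lemma entry_item_entries:
  assumes "distinct (map fst its)" "(i, j, p) \<in> set its"
  shows "entry (item_entries f g its) [i, k, 1] = (if k = j then f p else 0)"
    and "entry (item_entries f g its) [i, k, 2] = (if k = Suc j then g p else 0)"
proof -
  have "map_of (item_entries f g its) [i, k, 1] = (if k = j then Some (f p) else None) \<and>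
        map_of (item_entries f g its) [i, k, 2] = (if k = Suc j then Some (g p) else None)"
    using assms
  proof (induction its)
    case (Cons x its)
    show ?case
    proof (cases "x = (i, j, p)")
      case True
      then show ?thesis
        using Cons.prems map_of_item_entries_eq_None[of i its f g] by simp
    next
      case False
      then have "(i, j, p) \<in> set its" and "fst x \<noteq> i"
        using Cons.prems by (auto simp: image_iff)
      then show ?thesis using Cons by (cases x) simp
    qed
  qed simp
  then show "entry (item_entries f g its) [i, k, 1] = (if k = j then f p else 0)"
    and "entry (item_entries f g its) [i, k, 2] = (if k = Suc j then g p else 0)"
    by (simp_all add: entry_def)
qed

section \<open>Feasibility of the allocation\<close>

text \<open>With the default 1, the group of an unlisted bin leaves no rest for the next
  bin.\<close>

definition fraction :: "(nat \<times> real) list \<Rightarrow> nat \<Rightarrow> real" where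
  "fraction bs k = (case map_of bs k of None \<Rightarrow> 1 | Some p \<Rightarrow> p)"

lemma fraction_simps [simp]:
  "fraction [] k = 1"
  "fraction ((j, p) # bs) k = (if k = j then p else fraction bs k)"
  by (simp_all add: fraction_def)

lemma entry_alpha_entries:
  "entry (alpha_entries bs) [k, 1] = (if k \<in> fst ` set bs then fraction bs k else 0)"
  "entry (alpha_entries bs) [0, 2] = 0"
  "entry (alpha_entries bs) [Suc k, 2] = (if k \<in> fst ` set bs then 1 - fraction bs k else 0)"
proof -
  have "map_of (alpha_entries bs) [k, 1] = map_of bs k"
    and "map_of (alpha_entries bs) [0, 2] = None"
    and "map_of (alpha_entries bs) [Suc k, 2] = map_option (\<lambda>p. 1 - p) (map_of bs k)"
    by (induction bs) (auto simp: alpha_entries_def)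
  then show "entry (alpha_entries bs) [k, 1] = (if k \<in> fst ` set bs then fraction bs k else 0)"
    "entry (alpha_entries bs) [0, 2] = 0"
    "entry (alpha_entries bs) [Suc k, 2] = (if k \<in> fst ` set bs then 1 - fraction bs k else 0)"
    unfolding entry_def fraction_def map_of_eq_None_iff[symmetric]
    by (auto split: option.splits simp del: One_nat_def simp: domIff dom_map_of_conv_image_fst[symmetric])
qed

lemma entry_y_entries: "entry (y_entries bs) [k] = (if k \<in> fst ` set bs then 1 else 0)"
  by (induction bs) (auto simp: y_entries_def entry_def)

text \<open>\<open>W k\<close> is the size of group k, which puts the fraction \<open>q k\<close>
  into bin k in stage 1 and the rest into bin k + 1 in stage 2; \<open>load\<close> bounds what bin
  k + 1 gets from groups k and k + 1. Bins 1 to K are open. No rest leaves bin m by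
  \<open>q m = 1\<close>, and none reaches a closed bin.\<close>

lemma feasible_of_split:
  fixes n m K :: nat and a :: "nat \<Rightarrow> real" and J :: "nat \<Rightarrow> nat" and q :: "nat \<Rightarrow> real"
  defines "W \<equiv> \<lambda>k. \<Sum>i\<in>{1..n}. if J i = k then a i else 0"
  assumes J: "\<And>i. i \<in> {1..n} \<Longrightarrow> J i \<in> {1..<Suc K}" "\<And>i. i \<in> {1..n} \<Longrightarrow> J i \<le> m"
    and q: "\<And>k. q k \<in> {0..1}" "q m = 1" "\<And>k. K \<le> k \<Longrightarrow> q k = 1"
    and load: "q 1 * W 1 \<le> C" "\<And>k. (1 - q k) * W k + q (Suc k) * W (Suc k) \<le> C"
    and x: "\<And>i k. i \<in> {1..n} \<Longrightarrow> x i k 1 = (if k = J i then 1 else 0)"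
      "\<And>i k. i \<in> {1..n} \<Longrightarrow> x i k 2 = (if k = Suc (J i) then 1 else 0)"
    and y: "\<And>k. y k = (if k \<in> {1..<Suc K} then 1 else 0)"
    and lam: "\<And>i k. i \<in> {1..n} \<Longrightarrow> lam i k 1 = (if k = J i then q (J i) else 0)"
      "\<And>i k. i \<in> {1..n} \<Longrightarrow> lam i k 2 = (if k = Suc (J i) then 1 - q (J i) else 0)"
    and alpha: "\<And>k. alpha k 1 = (if k \<in> {1..<Suc K} then q k else 0)"
      "alpha 0 2 = 0" "\<And>k. alpha (Suc k) 2 = (if k \<in> {1..<Suc K} then 1 - q k else 0)"
  shows "feasible n a C m 2 x y lam alpha"
proof -
  note One_nat_def [simp del]
  have stages: "{1..2::nat} = {1, 2}" by auto
  have alpha2: "alpha k 2 = (if k - 1 \<in> {1..<Suc K} then 1 - q (k - 1) else 0)" if "1 \<le> k" for k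
    using alpha(3)[of "k - 1"] that by simp
  have first: "(\<Sum>i\<in>{1..n}. a i * lam i k 1) = q k * W k" for k
    unfolding W_def sum_distrib_left by (intro sum.cong) (auto simp: lam)
  have second: "(\<Sum>i\<in>{1..n}. a i * lam i (Suc k) 2) = (1 - q k) * W k" for k
    unfolding W_def sum_distrib_left by (intro sum.cong) (auto simp: lam)
  have W0: "W k = 0" if "k \<notin> {1..<Suc K}" for k
    unfolding W_def using J(1) that by (intro sum.neutral) auto
  have cap: "(\<Sum>i\<in>{1..n}. \<Sum>l\<in>{1..2}. a i * lam i k l) \<le> C * y k" if k: "k \<in> {1..m}" for k
  proof -
    have *: "(\<Sum>i\<in>{1..n}. \<Sum>l\<in>{1..2}. a i * lam i k l) = q k * W k + (1 - q (k - 1)) * W (k - 1)"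
      using first[of k] second[of "k - 1"] k by (simp add: stages sum.distrib)
    show ?thesis
    proof (cases "k \<in> {1..<Suc K}")
      case True
      then show ?thesis
        using * y[of k] load(1) load(2)[of "k - 1"] W0[of 0] by (cases "k = 1") auto
    next
      case False
      \<comment> \<open>Here k > K: the closed bin gets neither a rest nor a group of its
        own.\<close>
      then have "q (k - 1) = 1" using k by (intro q(3)) auto
      then show ?thesis using * W0[OF False] y[of k] False by auto
    qed
  qed
  have total: "(\<Sum>k\<in>{1..m}. \<Sum>l\<in>{1..2}. lam i k l) = 1" if i: "i \<in> {1..n}" for i
  proof -
    have "(\<Sum>k\<in>{1..m}. \<Sum>l\<in>{1..2}. lam i k l) =
        (\<Sum>k\<in>{1..m}. if k = J i then q (J i) else 0) + (\<Sum>k\<in>{1..m}. if k = Suc (J i) then 1 - q (J i) else 0)"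
      by (simp add: stages sum.distrib lam[OF i] del: sum.delta sum.delta')
    also have "\<dots> = 1"
      \<comment> \<open>For \<open>J i = m\<close> the second sum is empty, but then the first is
        already \<open>q m = 1\<close>.\<close>
      using J[OF i] q(2) by (cases "J i = m") auto
    finally show ?thesis .
  qed
  have once: "(\<Sum>k\<in>{1..m}. x i k l) \<le> 1" if "i \<in> {1..n}" "l \<in> {1..2}" for i l
    using that unfolding stages by (auto simp: x)
  show ?thesis
    unfolding feasible_def
  proof (intro conjI ballI)
    fix k l assume "k \<in> {1..m}" "l \<in> {1..2::nat}"
    then show "alpha k l \<in> {0..1}"
      using q(1)[of k] q(1)[of "k - 1"] alpha(1)[of k] alpha2[of k] by (auto simp: stages)
  next
    fix i k l assume "i \<in> {1..n}" "k \<in> {1..m}" "l \<in> {1..2::nat}"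
    then show "lam i k l \<in> {0..1}" "x i k l \<in> {0, 1}" "lam i k l = alpha k l * x i k l"
      using q(1)[of "J i"] J[of i] alpha(1)[of k] alpha2[of k]
      unfolding stages by (auto simp: x lam)
  qed (use cap total once y in auto)
qed

text \<open>Volume argument: summed over the bins, the stored parts give the total size, and each
  bin holds at most C.\<close>

lemma BMBP_lower_bound:
  assumes "BMBP n a C m k" "0 < C"
  shows "nat \<lceil>(\<Sum>i\<in>{1..n}. a i) / C\<rceil> \<le> m"
proof -
  obtain x y lam alpha where f: "feasible n a C m k x y lam alpha"
    using assms(1) by (auto simp: BMBP_def)
  then have y: "\<forall>j\<in>{1..m}. y j \<in> {0, 1}" by (simp add: feasible_def)
  have "(\<Sum>i\<in>{1..n}. a i) = (\<Sum>i\<in>{1..n}. a i * (\<Sum>j\<in>{1..m}. \<Sum>l\<in>{1..k}. lam i j l))"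
    using f by (intro sum.cong) (auto simp: feasible_def)
  also have "\<dots> = (\<Sum>j\<in>{1..m}. \<Sum>i\<in>{1..n}. \<Sum>l\<in>{1..k}. a i * lam i j l)"
    unfolding sum_distrib_left by (rule sum.swap)
  also have "\<dots> \<le> (\<Sum>j\<in>{1..m}. C * y j)"
    using f unfolding feasible_def by (intro sum_mono) blast
  also have "\<dots> \<le> (\<Sum>j\<in>{1..m}. C)"
    using y assms(2) by (intro sum_mono) fastforce
  finally have "(\<Sum>i\<in>{1..n}. a i) / C \<le> real m"
    using assms(2) by (simp add: field_simps)
  then show ?thesis by (simp add: ceiling_le_iff nat_le_iff)
qed

section \<open>Invariant and guarantee of the packing\<close>

definition group_size :: "(nat \<Rightarrow> real) \<Rightarrow> (nat \<times> nat \<times> real) list \<Rightarrow> nat \<Rightarrow> real" where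
  "group_size a its k = (\<Sum>(i, k', p)\<leftarrow>its. if k' = k then a i else 0)"

lemma group_size_simps [simp]:
  "group_size a [] k = 0"
  "group_size a ((i, j, p) # its) k = (if j = k then a i else 0) + group_size a its k"
  by (simp_all add: group_size_def)

lemma group_size_eq_0: "\<forall>(i, j, p)\<in>set its. j \<noteq> k \<Longrightarrow> group_size a its k = 0"
  by (induction its) auto

text \<open>The invariant of \<open>pack\<close>. While big objects remain, no group is pending and
  there are at least as many objects as bins j to m. The last conjunct is the volume bound for bins
  j to m, where \<open>C - c\<close> is already used in bin j.\<close>

definition packable ::
  "(nat \<Rightarrow> real) \<Rightarrow> real \<Rightarrow> nat \<Rightarrow> nat \<Rightarrow> real \<Rightarrow> real \<Rightarrow> nat list \<Rightarrow> nat list \<Rightarrow> bool" where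
  "packable a C m j c g B S \<longleftrightarrow>
     c \<le> C \<and> 0 \<le> g \<and> g \<le> c \<and>
     (\<forall>i\<in>set B \<union> set S. 0 < a i) \<and> (\<forall>b\<in>set B. C < a b) \<and> (\<forall>s\<in>set S. a s \<le> C) \<and>
     (\<forall>b\<in>set B. \<forall>s\<in>set S. a b \<le> C + a s) \<and>
     (B \<noteq> [] \<longrightarrow> g = 0 \<and> m + 1 \<le> j + length B + length S) \<and>
     (C - c) + g + (\<Sum>i\<leftarrow>B @ S. a i) + real j * C \<le> (real m + 1) * C"

text \<open>The guarantee for the result of \<open>pack\<close>. The size \<open>g\<close> of the
  objects already in group j is added separately, since these are not in \<open>its\<close>. Bin j
  is measured against its room \<open>c\<close>, later bins against C.\<close>

definition good_packing ::
  "(nat \<Rightarrow> real) \<Rightarrow> real \<Rightarrow> nat \<Rightarrow> nat \<Rightarrow> real \<Rightarrow> real \<Rightarrow>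
   real \<Rightarrow> (nat \<times> nat \<times> real) list \<Rightarrow> (nat \<times> real) list \<Rightarrow> bool" where
  "good_packing a C m j c g p its bs \<longleftrightarrow>
     bs \<noteq> [] \<and> map fst bs = [j..<j + length bs] \<and> fraction bs j = p \<and>
     (\<forall>k. fraction bs k \<in> {0..1}) \<and> fraction bs m = 1 \<and> (\<forall>k. j + length bs \<le> Suc k \<longrightarrow> fraction bs k = 1) \<and>
     (\<forall>(i, k, r)\<in>set its. k \<in> {j..<j + length bs} \<and> k \<le> m \<and> r = fraction bs k) \<and>
     p * (g + group_size a its j) \<le> c \<and>
     (\<forall>k\<ge>j. (1 - fraction bs k) * ((if k = j then g else 0) + group_size a its k) +
        fraction bs (Suc k) * group_size a its (Suc k) \<le> C)"

text \<open>The invariant rules out the failure of \<open>pick\<close>. While big objects remain,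
  the picked object alone fills the room: a big one because \<open>c \<le> C\<close>, a small one
  because sizes differ by at most C.\<close>

lemma packable_pick:
  assumes "packable a C m j c g B S" "0 < C" "B \<noteq> [] \<or> S \<noteq> []"
  obtains i B' S' where "pick a (C + c - g) B S = Some (i, B', S')" "0 < a i" "g + a i \<le> C + c"
    "B \<noteq> [] \<Longrightarrow> c \<le> g + a i" "B' \<noteq> [] \<Longrightarrow> B \<noteq> []"
    "set B' \<subseteq> set B" "set S' \<subseteq> set S"
    "length B + length S = Suc (length B' + length S')"
    "(\<Sum>k\<leftarrow>B @ S. a k) = a i + (\<Sum>k\<leftarrow>B' @ S'. a k)"
proof (cases B)
  case Nil
  then obtain s S' where "S = s # S'" using assms(3) by (cases S) auto
  then show ?thesis using Nil assms(1) by (intro that[of s "[]" S']) (auto simp: packable_def)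
next
  case (Cons b B')
  show ?thesis
  proof (cases "a b \<le> C + c - g")
    case True
    then show ?thesis using Cons assms(1) by (intro that[of b B' S]) (auto simp: packable_def)
  next
    case False
    \<comment> \<open>Otherwise every bin from j to m is matched by a big object, each larger than
      C, and b alone exceeds \<open>C + c\<close>, against the volume bound.\<close>
    have "S \<noteq> []"
    proof
      assume S: "S = []"
      have "real (length B') * C \<le> (\<Sum>i\<leftarrow>B'. a i)"
        using sum_list_mono[of B' "\<lambda>_. C" a] Cons assms(1)
        by (auto simp: packable_def sum_list_triv less_imp_le)
      moreover have "(C - c) + a b + (\<Sum>i\<leftarrow>B'. a i) + real j * C \<le> (real m + 1) * C"
        and "m + 1 \<le> j + Suc (length B')" and "g = 0"
        using assms(1) Cons S by (auto simp: packable_def algebra_simps)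
      moreover have "(real m + 1) * C \<le> (real j + 1 + real (length B')) * C"
        using calculation(3) assms(2) by (intro mult_right_mono) auto
      ultimately show False using False assms(2) by (simp add: algebra_simps)
    qed
    then obtain s S' where S: "S = s # S'" by (cases S) auto
    \<comment> \<open>As b does not fit, \<open>C + c < a b \<le> C + a s\<close>, so s exceeds the
      room c.\<close>
    then show ?thesis using Cons assms(1) False
      by (intro that[of s B S']) (auto simp: packable_def)
  qed
qed

lemma good_packing_pack:
  assumes "0 < C"
  shows "packable a C m j c g B S \<Longrightarrow> pack a C j c g B S = (p, its, bs) \<Longrightarrow>
    mset (map fst its) = mset B + mset S \<and> good_packing a C m j c g p its bs"
  using assms
proof (induction a C j c g B S arbitrary: p its bs rule: pack.induct)
  case (1 a C j c g B S)
  note ok = 1(3) and res = 1(4) and C = 1(5)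
  show ?case
  proof (cases "B \<noteq> [] \<or> S \<noteq> []")
    case False
    then have "p = 1" "its = []" "bs = [(j, 1)]" "g \<le> c"
      using res ok by (auto simp: pack.simps packable_def)
    then show ?thesis using False C by (auto simp: good_packing_def)
  next
    case True
    from ok C True obtain i B' S' where
      pick: "pick a (C + c - g) B S = Some (i, B', S')" and i: "0 < a i" "g + a i \<le> C + c" and
      big: "B \<noteq> [] \<Longrightarrow> c \<le> g + a i" "B' \<noteq> [] \<Longrightarrow> B \<noteq> []" and
      sub: "set B' \<subseteq> set B" "set S' \<subseteq> set S" and
      len: "length B + length S = Suc (length B' + length S')" and
      size: "(\<Sum>k\<leftarrow>B @ S. a k) = a i + (\<Sum>k\<leftarrow>B' @ S'. a k)"
      by (rule packable_pick) blast
    have mset: "mset B + mset S = add_mset i (mset B' + mset S')"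
      using mset_pick[OF pick] by simp
    have nonneg: "0 \<le> (\<Sum>k\<leftarrow>B' @ S'. a k)"
      using ok sub by (intro sum_list_nonneg) (auto simp: packable_def less_imp_le)
    define g' where "g' = g + a i"
    have g': "0 < g'" "g' \<le> C + c" using i ok by (auto simp: g'_def packable_def)
    have cap: "(C - c) + g' + (\<Sum>k\<leftarrow>B' @ S'. a k) + real j * C \<le> (real m + 1) * C"
      using ok size by (simp add: packable_def g'_def)
    have c: "0 \<le> c" "c \<le> C" using ok by (auto simp: packable_def)
    \<comment> \<open>Positive size remains to be stored, so bin j is one of the m bins.\<close>
    have "real j * C < (real m + 1) * C"
      using cap nonneg g' c by linarith
    then have j: "j \<le> m" using C by simp
    have sub_ok: "\<forall>i\<in>set B' \<union> set S'. 0 < a i" "\<forall>b\<in>set B'. C < a b" "\<forall>s\<in>set S'. a s \<le> C"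
      "\<forall>b\<in>set B'. \<forall>s\<in>set S'. a b \<le> C + a s"
      using ok sub unfolding packable_def by blast+
    show ?thesis
    proof (cases "c \<le> g'")
      case True
      obtain p' its' bs' where r: "pack a C (Suc j) (C + c - g') 0 B' S' = (p', its', bs')"
        by (cases "pack a C (Suc j) (C + c - g') 0 B' S'")
      have p: "p = c / g'" and its: "its = (i, j, p) # its'" and bs: "bs = (j, p) # bs'"
        using res True pick r by (auto simp: pack.simps[of a C j] g'_def)
      \<comment> \<open>The rest \<open>g' - c\<close> is charged to bin j + 1. One bin and one
        object are used up, which preserves the count.\<close>
      have "packable a C m (Suc j) (C + c - g') 0 B' S'"
        using True g' c sub_ok cap ok len big(2)
        by (auto simp: packable_def algebra_simps)
      then have m': "mset (map fst its') = mset B' + mset S'"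
        and good: "good_packing a C m (Suc j) (C + c - g') 0 p' its' bs'"
        using 1(1)[OF pick refl refl True[unfolded g'_def] _ _ C] r by (auto simp: g'_def)
      have p01: "p \<in> {0..1}" using p True g' c by simp
      have pg: "p * g' = c" using p g' by simp
      \<comment> \<open>For the last bin the volume bound gives \<open>g' \<le> c\<close>, so the
        group fits exactly.\<close>
      have pm: "p = 1" if "j = m"
        using cap nonneg that True p g' by (simp add: algebra_simps)
      have no_j: "group_size a its' j = 0"
        using good by (intro group_size_eq_0) (auto simp: good_packing_def)
      have loads: "(1 - fraction bs k) * ((if k = j then g else 0) + group_size a its k) +
        fraction bs (Suc k) * group_size a its (Suc k) \<le> C" if "j \<le> k" for k
      proof (cases "k = j")
        case True
        \<comment> \<open>The rest of group j is exactly what was subtracted from the room of bin j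
          + 1, so the two parts add up to at most C.\<close>
        have "(1 - p) * (g + a i) = g' - c"
          using pg by (simp add: g'_def algebra_simps)
        moreover have "p' * group_size a its' (Suc j) \<le> C + c - g'" "fraction bs' (Suc j) = p'"
          using good by (auto simp: good_packing_def)
        ultimately show ?thesis using True by (simp add: its bs no_j)
      next
        case False
        then have "Suc j \<le> k" using that by simp
        then have "(1 - fraction bs' k) * ((if k = Suc j then 0 else 0) + group_size a its' k) +
            fraction bs' (Suc k) * group_size a its' (Suc k) \<le> C"
          using good by (simp add: good_packing_def)
        then show ?thesis using \<open>Suc j \<le> k\<close> by (simp add: its bs)
      qed
      show ?thesis
        using good m' mset j p01 pm pg no_j loads
        by (auto simp: good_packing_def its bs g'_def upt_conv_Cons simp del: upt_Suc)
    next
      case False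
      obtain p' its' where r: "pack a C j c g' B' S' = (p', its', bs)"
        and p: "p = p'" and its: "its = (i, j, p) # its'"
        using res False pick by (auto simp: pack.simps[of a C j c g] g'_def split: prod.splits)
      \<comment> \<open>By \<open>big\<close> no big object remains, so a pending group is
        allowed.\<close>
      have "packable a C m j c g' B' S'"
        using False g' c sub_ok cap ok len big
        by (auto simp: packable_def g'_def)
      then have m': "mset (map fst its') = mset B' + mset S'"
        and good: "good_packing a C m j c g' p its' bs"
        using 1(2)[OF pick refl refl False[unfolded g'_def] _ _ C] r p by (auto simp: g'_def)
      \<comment> \<open>The new object only moves from the pending size into the listed part of its
        group.\<close>
      have "(1 - fraction bs k) * ((if k = j then g else 0) + group_size a its k) =
          (1 - fraction bs k) * ((if k = j then g' else 0) + group_size a its' k)" for k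
        by (simp add: its g'_def)
      then show ?thesis
        using good m' mset j
        by (auto simp: good_packing_def its g'_def add.assoc)
    qed
  qed
qed

lemma feasible_pack:
  assumes pos: "\<And>i. i \<in> {1..n} \<Longrightarrow> 0 < a i" and C: "0 < C"
    and diff: "\<And>i k. i \<in> {1..n} \<Longrightarrow> k \<in> {1..n} \<Longrightarrow> a i \<le> C + a k"
    and sum: "(\<Sum>i\<in>{1..n}. a i) \<le> real m * C" and mn: "m \<le> n"
    and res: "pack a C 1 C 0 (filter (\<lambda>i. \<not> a i \<le> C) [1..<Suc n]) (filter (\<lambda>i. a i \<le> C) [1..<Suc n]) = (p, its, bs)"
  shows "feasible n a C m 2 (\<lambda>i k l. entry (item_entries (\<lambda>_. 1) (\<lambda>_. 1) its) [i, k, l])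
    (\<lambda>k. entry (y_entries bs) [k]) (\<lambda>i k l. entry (item_entries (\<lambda>p. p) (\<lambda>p. 1 - p) its) [i, k, l])
    (\<lambda>k l. entry (alpha_entries bs) [k, l])"
proof -
  note upt_Suc [simp del] One_nat_def [simp del]
  let ?B = "filter (\<lambda>i. \<not> a i \<le> C) [1..<Suc n]" and ?S = "filter (\<lambda>i. a i \<le> C) [1..<Suc n]"
  have mset: "mset ?B + mset ?S = mset [1..<Suc n]"
    unfolding mset_filter by (metis add.commute multiset_partition)
  have "mset (map a ?B) + mset (map a ?S) = mset (map a [1..<Suc n])"
    using arg_cong[OF mset, of "image_mset a"] by simp
  then have "(\<Sum>i\<leftarrow>?B @ ?S. a i) = (\<Sum>i\<leftarrow>[1..<Suc n]. a i)"
    by (metis map_append mset_append sum_mset_sum_list)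
  also have "\<dots> = (\<Sum>i\<in>{1..n}. a i)"
    by (simp add: sum_list_distinct_conv_sum_set atLeastLessThanSuc_atLeastAtMost)
  finally have "(\<Sum>i\<leftarrow>?B @ ?S. a i) \<le> real m * C" using sum by simp
  moreover have "length ?B + length ?S = n"
    using sum_length_filter_compl[of "\<lambda>i. a i \<le> C" "[1..<Suc n]"] by simp
  \<comment> \<open>For j = 1 the counting condition is \<open>m \<le> n\<close>.\<close>
  ultimately have "packable a C m 1 C 0 ?B ?S"
    unfolding packable_def using pos diff mn C by (auto simp: algebra_simps)
  then have its: "mset (map fst its) = mset [1..<Suc n]" and good: "good_packing a C m 1 C 0 p its bs"
    using good_packing_pack[OF C _ res] mset by auto
  have dist: "distinct (map fst its)" and set_its: "fst ` set its = {1..n}"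
    using mset_eq_imp_distinct_iff[OF its] mset_eq_setD[OF its] by auto
  have set_bs: "fst ` set bs = {1..<Suc (length bs)}"
    using good by (metis good_packing_def plus_1_eq_Suc set_map set_upt)
  define J where "J i = fst (the (map_of its i))" for i
  have J_eq: "J i = k" if "(i, k, r) \<in> set its" for i k r
    using that dist by (simp add: J_def)
  have J: "(i, J i, fraction bs (J i)) \<in> set its" "J i \<in> {1..<Suc (length bs)}" "J i \<le> m" if i: "i \<in> {1..n}" for i
  proof -
    obtain k r where "(i, k, r) \<in> set its" using i unfolding set_its[symmetric] by auto
    then show "(i, J i, fraction bs (J i)) \<in> set its" "J i \<in> {1..<Suc (length bs)}" "J i \<le> m"
      using J_eq[of i k r] good by (auto simp: good_packing_def)
  qed
  have group: "group_size a its k = (\<Sum>i\<in>{1..n}. if J i = k then a i else 0)" for k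
  proof -
    have "group_size a its k = (\<Sum>i\<leftarrow>map fst its. if J i = k then a i else 0)"
      unfolding group_size_def map_map
      by (intro arg_cong[of _ _ sum_list] map_cong) (auto simp: J_eq)
    also have "\<dots> = (\<Sum>i\<in>{1..n}. if J i = k then a i else 0)"
      using dist set_its by (simp only: sum_list_distinct_conv_sum_set) simp
    finally show ?thesis .
  qed
  have group0: "group_size a its 0 = 0"
    using good by (intro group_size_eq_0) (auto simp: good_packing_def)
  have load1: "fraction bs 1 * group_size a its 1 \<le> C"
    using good by (auto simp: good_packing_def)
  have load: "(1 - fraction bs k) * group_size a its k + fraction bs (Suc k) * group_size a its (Suc k) \<le> C" for k
  proof (cases k)
    case 0
    then show ?thesis using load1 group0 by (simp add: One_nat_def)
  next
    case (Suc k')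
    then have "1 \<le> k" by simp
    then have "(1 - fraction bs k) * ((if k = 1 then 0 else 0) + group_size a its k) +
        fraction bs (Suc k) * group_size a its (Suc k) \<le> C"
      using good unfolding good_packing_def by blast
    then show ?thesis by simp
  qed
  show ?thesis
  proof (rule feasible_of_split[where J = J and q = "fraction bs" and K = "length bs"])
    show "fraction bs 1 * (\<Sum>i = 1..n. if J i = 1 then a i else 0) \<le> C"
      using load1 by (simp only: group)
    show "(1 - fraction bs k) * (\<Sum>i = 1..n. if J i = k then a i else 0) +
         fraction bs (Suc k) * (\<Sum>i = 1..n. if J i = Suc k then a i else 0) \<le> C" for k
      using load by (simp only: group)
  qed (use good J(2,3) entry_item_entries[OF dist J(1)] set_bs in
      \<open>auto simp: good_packing_def entry_y_entries entry_alpha_entries\<close>)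
qed

text \<open>The hypotheses are invariant under reordering the objects, so that they carry over to
  \<open>a \<circ> p\<close>.\<close>

lemma packer_correct:
  assumes "\<And>i. i \<in> {1..n} \<Longrightarrow> 0 < a i" "0 < C"
    and "\<And>i k. i \<in> {1..n} \<Longrightarrow> k \<in> {1..n} \<Longrightarrow> a i \<le> C + a k"
    and "(\<Sum>i\<in>{1..n}. a i) \<le> real m * C" "m \<le> n"
  shows "\<exists>w t x y lam alpha. runs packer (input_val n a C) w t \<and> t \<le> 1100 * n + 2000 \<and>
    encodes w x y lam alpha \<and> feasible n a C m 2 x y lam alpha"
proof -
  obtain p its bs where res: "pack a C 1 C 0 (filter (\<lambda>i. \<not> a i \<le> C) [1..<Suc n])
      (filter (\<lambda>i. a i \<le> C) [1..<Suc n]) = (p, its, bs)"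
    by (metis prod_cases3)
  have feas: "feasible n a C m 2 (\<lambda>i k l. entry (item_entries (\<lambda>_. 1) (\<lambda>_. 1) its) [i, k, l])
    (\<lambda>k. entry (y_entries bs) [k]) (\<lambda>i k l. entry (item_entries (\<lambda>p. p) (\<lambda>p. 1 - p) its) [i, k, l])
    (\<lambda>k l. entry (alpha_entries bs) [k, l])"
    by (rule feasible_pack) (use assms res in auto)
  obtain t where "runs packer (input_val n a C) (List (tl (pack_vals (p, its, bs)))) t" "t \<le> 1100 * n + 2000"
    using runs_packer[of n a C] assms(1) unfolding res by blast
  moreover have "encodes (List (tl (pack_vals (p, its, bs))))
      (\<lambda>i k l. entry (item_entries (\<lambda>_. 1) (\<lambda>_. 1) its) [i, k, l]) (\<lambda>k. entry (y_entries bs) [k])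
      (\<lambda>i k l. entry (item_entries (\<lambda>p. p) (\<lambda>p. 1 - p) its) [i, k, l]) (\<lambda>k l. entry (alpha_entries bs) [k, l])"
    unfolding encodes_def by auto
  ultimately show ?thesis using feas by blast
qed

section \<open>Asymptotic bound and conclusion\<close>

lemma linear_bigo_n_ln_n: "(\<lambda>n. real (1100 * n + 2000)) \<in> O(\<lambda>n. real n * ln (real n))"
proof (rule bigoI)
  show "\<forall>\<^sub>F n in sequentially. norm (real (1100 * n + 2000)) \<le> 3100 * norm (real n * ln (real n))"
    using eventually_ge_at_top[of 3]
  proof eventually_elim
    case (elim n)
    \<comment> \<open>From n = 3 on the logarithm is at least 1, and 3100 = 1100 + 2000 absorbs the
      constant term.\<close>
    have "exp 1 \<le> real n" using exp_le elim by linarith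
    then have "1 \<le> ln (real n)" using elim by (simp add: ln_ge_iff)
    have "norm (real (1100 * n + 2000)) \<le> 3100 * real n" using elim by simp
    also have "\<dots> \<le> 3100 * norm (real n * ln (real n))"
      using \<open>1 \<le> ln (real n)\<close> by (simp add: abs_mult mult_le_cancel_left1)
    finally show ?case .
  qed
qed

theorem theorem2:
  "(\<forall>(n::nat) (a::nat \<Rightarrow> real) (C::real) (m::nat).
      1 \<le> n \<and> (\<forall>i\<in>{1..n}. \<forall>j\<in>{1..n}. i \<le> j \<longrightarrow> a j \<le> a i) \<and> 0 < a n \<and> 0 < C \<and>
      m = nat \<lceil>(\<Sum>i\<in>{1..n}. a i) / C\<rceil> \<and> a 1 - a n \<le> C \<and> m \<le> n \<longrightarrow>
      BMBP n a C m 2 \<and> (\<forall>m' k'. BMBP n a C m' k' \<longrightarrow> m \<le> m')) \<and>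
   (\<exists>(P::prog) (T::nat \<Rightarrow> nat).
      (\<lambda>n. real (T n)) \<in> O(\<lambda>n. real n * ln (real n)) \<and>
      (\<forall>(n::nat) (a::nat \<Rightarrow> real) (C::real) (m::nat) (p::nat \<Rightarrow> nat).
         1 \<le> n \<and> (\<forall>i\<in>{1..n}. \<forall>j\<in>{1..n}. i \<le> j \<longrightarrow> a j \<le> a i) \<and> 0 < a n \<and> 0 < C \<and>
         m = nat \<lceil>(\<Sum>i\<in>{1..n}. a i) / C\<rceil> \<and> a 1 - a n \<le> C \<and> m \<le> n \<and>
         p permutes {1..n} \<longrightarrow>
         (\<exists>w t x y lam alpha.
            runs P (input_val n (a \<circ> p) C) w t \<and> t \<le> T n \<and>
            encodes w x y lam alpha \<and> feasible n (a \<circ> p) C m 2 x y lam alpha)))"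
proof -
  have solved: "\<exists>w t x y lam alpha. runs packer (input_val n (a \<circ> p) C) w t \<and>
      t \<le> 1100 * n + 2000 \<and> encodes w x y lam alpha \<and> feasible n (a \<circ> p) C m 2 x y lam alpha"
    if "1 \<le> n \<and> (\<forall>i\<in>{1..n}. \<forall>j\<in>{1..n}. i \<le> j \<longrightarrow> a j \<le> a i) \<and> 0 < a n \<and> 0 < C \<and>
      m = nat \<lceil>(\<Sum>i\<in>{1..n}. a i) / C\<rceil> \<and> a 1 - a n \<le> C \<and> m \<le> n \<and> p permutes {1..n}"
    for n m :: nat and a :: "nat \<Rightarrow> real" and C :: real and p :: "nat \<Rightarrow> nat"
  proof (rule packer_correct)
    \<comment> \<open>All sizes lie between \<open>a n\<close> and \<open>a 1\<close>, so any two
      differ by at most C.\<close>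
    have bounds: "a n \<le> a (p i)" "a (p i) \<le> a 1" if "i \<in> {1..n}" for i
      using \<open>1 \<le> n \<and> _\<close> permutes_in_image[of p "{1..n}" i] that by auto
    show "0 < (a \<circ> p) i" if "i \<in> {1..n}" for i
      using bounds[OF that] \<open>1 \<le> n \<and> _\<close> by simp
    show "(a \<circ> p) i \<le> C + (a \<circ> p) k" if "i \<in> {1..n}" "k \<in> {1..n}" for i k
      using bounds[OF that(1)] bounds[OF that(2)] \<open>1 \<le> n \<and> _\<close> by simp
    have "(\<Sum>i\<in>{1..n}. (a \<circ> p) i) = (\<Sum>i\<in>{1..n}. a i)"
      using that by (metis sum.permute)
    moreover have "(\<Sum>i\<in>{1..n}. a i) / C \<le> real m" 
      using that by (metis real_nat_ceiling_ge)
    ultimately show "(\<Sum>i\<in>{1..n}. (a \<circ> p) i) \<le> real m * C"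
      using that by (simp add: field_simps)
  qed (use that in auto)
  have "BMBP n a C m 2"
    if "1 \<le> n \<and> (\<forall>i\<in>{1..n}. \<forall>j\<in>{1..n}. i \<le> j \<longrightarrow> a j \<le> a i) \<and> 0 < a n \<and> 0 < C \<and>
      m = nat \<lceil>(\<Sum>i\<in>{1..n}. a i) / C\<rceil> \<and> a 1 - a n \<le> C \<and> m \<le> n"
    for n m :: nat and a :: "nat \<Rightarrow> real" and C :: real
    \<comment> \<open>The identity permutation turns the output of the algorithm into the existence
      claim.\<close>
    using solved[of n a C m id] that permutes_id[of "{1..n}"] unfolding BMBP_def comp_id by blast
  then show ?thesis
    by (intro conjI allI impI exI[of _ packer] exI[of _ "\<lambda>n. 1100 * n + 2000"])
      (assumption | rule linear_bigo_n_ln_n | erule solved | elim conjE, simp only: BMBP_lower_bound)+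
qed

end
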